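(* Let $d\ge1$, $L\ge2$, $1\le i,j\le d$, let $z=z_1\dots z_m$ be a nonempty word in the alphabet $[L]$, let $\widehat w\in\widehat W_L$ and let $w=w_1\dots w_n$ be an arbitrary representative of $\widehat w$. The Poisson bracket in $P_{d,L}$ between the generators $p_{ij}(z)$ of $\mathcal Y_{d,L}$ and $p(\widehat w)$ of $P_{0,L}$ has the form $$\{p_{ij}(z),p(\widehat w)\}=\sum_{r=1}^m\sum_{q=1}^n\delta_{z_r,w_q}\Bigl(p_{ij}(z_1\dots z_{r-1}z_rw_{q+1}\dots w_nw_1\dots w_{q-1}z_{r+1}\dots z_m)-p_{ij}(z_1\dots z_{r-1}w_{q+1}\dots w_nw_1\dots w_{q-1}z_rz_{r+1}\dots z_m)\Bigr).$$
   Context: The ground field is $\mathbb C$. $E_{ij\mid\alpha}$ denotes the matrix unit $E_{ij}$ in the $\alpha$-th copy of $\mathfrak{gl}(N,\mathbb C)$ in $\mathfrak{gl}(N,\mathbb C)^{\oplus L}$, $\alpha\in[L]=\{1,\dots,L\}$; $S(\cdot)$ is the symmetric algebra. For $0\le d\le N$, $\mathfrak{gl}_d(N,\mathbb C)$ is the span of $E_{ij}$ with $d<i,j\le N$; $\operatorname{diag}$ is the diagonal embedding; $P_{d,L}(N):=S(\mathfrak{gl}(N,\mathbb C)^{\oplus L})^{\operatorname{diag}\mathfrak{gl}_d(N,\mathbb C)}$ (adjoint invariants). Let $\mathcal I^+(N)$ be the ideal of $S(\mathfrak{gl}(N,\mathbb C)^{\oplus L})$ generated by all $E_{iN\mid\alpha}$,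 $1\le i\le N$, $\alpha\in[L]$. Then $P_{N-1,L}(N)=S(\mathfrak{gl}(N-1,\mathbb C)^{\oplus L})\oplus(P_{N-1,L}(N)\cap\mathcal I^+(N))$; the projection $\pi_{N,N-1}$ onto the first summand maps $P_{d,L}(N)$ into $P_{d,L}(N-1)$ for $d\le N-1$. $P_{d,L}:=\varprojlim(P_{d,L}(N),\pi_{N,N-1})$ in the category of graded algebras; $P_{0,L}\subset P_{d,L}$ by restricting sequences to $N\ge d$. $P_{d,L}$ carries the Poisson bracket $\{-,-\}$ of degree $-1$ which comes, levelwise in $N$, from the canonical Poisson bracket of $S(\mathfrak{gl}(N,\mathbb C)^{\oplus L})$ (extending the Lie bracket by the Leibniz rule); the maps $\pi_{N,N-1}$ are Poisson on the algebras $P_{d,L}(N)$. Equivalently, it is induced by the commutator of the filtered algebra $A_{d,L}=\varprojlim U(\mathfrak{gl}(N,\mathbb C)^{\oplus L})^{\operatorname{diag}\mathfrak{gl}_d(N,\mathbb C)}$, for which $\operatorname{gr}A_{d,L}\simeq P_{d,L}$. $\widehat W_L$ is the set of circular words: classes of nonempty words in the alphabet $[L]$ under cyclic permutations of letters. For a nonempty word $w=w_1\dots w_n$ with class $\widehat w$, $p(\widehat w)\in P_{0,L}$ is defined by the sequence $p(\widehat w;N)=\sum_{a_1,\dots,a_n=1}^N E_{a_1a_2\mid w_1}E_{a_2a_3\mid w_2}\cdots E_{a_na_1\mid w_n}$, and for $1\le i,j\le d$, $p_{ij}(w)\in P_{d,L}$ is defined by the sequence $p_{ij}(w;N)=\sum_{a_1,\dots,a_{n-1}=1}^N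 E_{ia_1\mid w_1}E_{a_1a_2\mid w_2}\cdots E_{a_{n-1}j\mid w_n}$. $\mathcal Y_{d,L}\subset P_{d,L}$ is the unital subalgebra generated by all $p_{ij}(w)$. *)

theory Defs
  imports Complex_Main "HOL-Library.Poly_Mapping" "HOL-Library.Function_Algebras" "HOL-Library.FuncSet"
begin

section \<open>The symmetric algebra of gl(N) taken L times\<close>

text \<open>
  The triple (i, j, alpha) stands for the matrix unit E_ij in the alpha-th copy of gl(N); all
  indices start at 1.  A symmetric algebra of a vector space is the polynomial algebra on a basis.
  All the algebras S(N, L) live in one ring of polynomials in the countably many variables
  (i, j, alpha), as the subrings of polynomials in the variables with i, j at most N and alpha
  at most L.
\<close>

type_synonym gen = "nat \<times> nat \<times> nat"
type_synonym spoly = "(gen \<Rightarrow>\<^sub>0 nat) \<Rightarrow>\<^sub>0 complex"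

definition E :: "nat \<Rightarrow> nat \<Rightarrow> nat \<Rightarrow> spoly" where
  "E i j \<alpha> = Poly_Mapping.single (Poly_Mapping.single (i, j, \<alpha>) 1) 1"

definition gens :: "nat \<Rightarrow> nat \<Rightarrow> gen set" where
  "gens N L = {1..N} \<times> {1..N} \<times> {1..L}"

definition Sym :: "nat \<Rightarrow> nat \<Rightarrow> spoly set" where
  "Sym N L = {f. \<forall>m \<in> Poly_Mapping.keys f. Poly_Mapping.keys m \<subseteq> gens N L}"

definition homogeneous :: "nat \<Rightarrow> spoly \<Rightarrow> bool" where
  "homogeneous k f \<longleftrightarrow>
     (\<forall>m \<in> Poly_Mapping.keys f. (\<Sum>x \<in> Poly_Mapping.keys m. Poly_Mapping.lookup m x) = k)"

section \<open>The canonical Poisson bracket\<close>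

definition pdiff :: "gen \<Rightarrow> spoly \<Rightarrow> spoly" where
  "pdiff x f = (\<Sum>m \<in> Poly_Mapping.keys f.
     Poly_Mapping.single (m - Poly_Mapping.single x 1)
       (Poly_Mapping.lookup f m * of_nat (Poly_Mapping.lookup m x)))"

fun lie :: "gen \<Rightarrow> gen \<Rightarrow> spoly" where
  "lie (i, j, \<alpha>) (k, l, \<beta>) =
     (if \<alpha> = \<beta> then (if j = k then E i l \<alpha> else 0) - (if i = l then E k j \<alpha> else 0) else 0)"

text \<open>
  The coordinate form of the bracket which extends the Lie bracket by the Leibniz rule.  The lemmas
  poisson_gens, poisson_leibniz, poisson_skew and the ones on linearity below say that it is indeed
  the skew-symmetric bilinear biderivation given by the Lie bracket on the generators.
\<close>

definition poisson :: "nat \<Rightarrow> nat \<Rightarrow> spoly \<Rightarrow> spoly \<Rightarrow> spoly" where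
  "poisson N L f g = (\<Sum>x \<in> gens N L. \<Sum>y \<in> gens N L. pdiff x f * pdiff y g * lie x y)"

lemma finite_gens [simp]: "finite (gens N L)"
  by (simp add: gens_def)

lemma pdiff_superset:
  assumes "finite A" "Poly_Mapping.keys f \<subseteq> A"
  shows "pdiff x f = (\<Sum>m \<in> A. Poly_Mapping.single (m - Poly_Mapping.single x 1)
       (Poly_Mapping.lookup f m * of_nat (Poly_Mapping.lookup m x)))"
  unfolding pdiff_def using assms
  by (intro sum.mono_neutral_left) (auto simp: in_keys_iff)

lemma pdiff_zero [simp]: "pdiff x 0 = 0"
  by (simp add: pdiff_def)

lemma pdiff_add: "pdiff x (f + g) = pdiff x f + pdiff x g"
proof -
  let ?A = "Poly_Mapping.keys f \<union> Poly_Mapping.keys g"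
  have "Poly_Mapping.keys (f + g) \<subseteq> ?A"
    by (rule Poly_Mapping.keys_add)
  then show ?thesis
    by (simp add: pdiff_superset[of ?A] lookup_add distrib_right single_add sum.distrib)
qed

lemma pdiff_sum: "pdiff x (\<Sum>i\<in>I. f i) = (\<Sum>i\<in>I. pdiff x (f i))"
  by (induction I rule: infinite_finite_induct) (simp_all add: pdiff_add)

lemma pdiff_single:
  "pdiff x (Poly_Mapping.single m c) =
     Poly_Mapping.single (m - Poly_Mapping.single x 1) (c * of_nat (Poly_Mapping.lookup m x))"
  by (subst pdiff_superset[of "{m}"]) auto

lemma pdiff_E: "pdiff x (E i j \<alpha>) = (if x = (i, j, \<alpha>) then 1 else 0)"
  by (auto simp: E_def pdiff_single lookup_single when_def)

lemma spoly_sum_single: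
  fixes f :: spoly
  shows "f = (\<Sum>m \<in> Poly_Mapping.keys f. Poly_Mapping.single m (Poly_Mapping.lookup f m))"
  by (rule poly_mapping_eqI)
    (simp add: lookup_sum lookup_single when_def in_keys_iff sum.delta)

lemma single_minus_add:
  fixes m n :: "gen \<Rightarrow>\<^sub>0 nat"
  assumes "Poly_Mapping.lookup m x \<noteq> 0"
  shows "m - Poly_Mapping.single x 1 + n = m + n - Poly_Mapping.single x 1"
  using assms by (intro poly_mapping_eqI) (auto simp: lookup_add lookup_minus lookup_single when_def)

lemma pdiff_mult_single:
  "pdiff x (Poly_Mapping.single m a * Poly_Mapping.single n b) =
     pdiff x (Poly_Mapping.single m a) * Poly_Mapping.single n b
     + Poly_Mapping.single m a * pdiff x (Poly_Mapping.single n b)"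
proof -
  let ?s = "Poly_Mapping.single (m + n - Poly_Mapping.single x 1)"
  let ?k = "\<lambda>m. of_nat (Poly_Mapping.lookup m x) :: complex"
  have 1: "pdiff x (Poly_Mapping.single m a) * Poly_Mapping.single n b = ?s (a * b * ?k m)"
  proof (cases "Poly_Mapping.lookup m x = 0")
    case False
    show ?thesis
      unfolding pdiff_single mult_single single_minus_add[OF False] by (simp add: mult_ac)
  qed (simp add: pdiff_single)
  have 2: "Poly_Mapping.single m a * pdiff x (Poly_Mapping.single n b) = ?s (a * b * ?k n)"
  proof (cases "Poly_Mapping.lookup n x = 0")
    case False
    show ?thesis
      unfolding pdiff_single mult_single add.commute[of m] single_minus_add[OF False]
      by (simp add: mult_ac)
  qed (simp add: pdiff_single)
  show ?thesis
    unfolding 1 2 by (simp add: mult_single pdiff_single lookup_add distrib_left single_add)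
qed

lemma pdiff_mult: "pdiff x (f * g) = pdiff x f * g + f * pdiff x g"
proof -
  let ?S = "\<lambda>f m. Poly_Mapping.single m (Poly_Mapping.lookup f m) :: spoly"
  have "pdiff x ((\<Sum>m \<in> Poly_Mapping.keys f. ?S f m) * (\<Sum>n \<in> Poly_Mapping.keys g. ?S g n)) =
      pdiff x (\<Sum>m \<in> Poly_Mapping.keys f. ?S f m) * (\<Sum>n \<in> Poly_Mapping.keys g. ?S g n)
      + (\<Sum>m \<in> Poly_Mapping.keys f. ?S f m) * pdiff x (\<Sum>n \<in> Poly_Mapping.keys g. ?S g n)"
    by (simp only: sum_product pdiff_sum pdiff_mult_single sum.distrib)
  then show ?thesis
    by (simp only: spoly_sum_single[symmetric])
qed

lemma lie_skew: "lie x y = - lie y x"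
  by (cases x; cases y) auto

lemma poisson_gens:
  assumes "(i, j, \<alpha>) \<in> gens N L" "(k, l, \<beta>) \<in> gens N L"
  shows "poisson N L (E i j \<alpha>) (E k l \<beta>) = lie (i, j, \<alpha>) (k, l, \<beta>)"
proof -
  have "poisson N L (E i j \<alpha>) (E k l \<beta>) = (\<Sum>x \<in> gens N L. \<Sum>y \<in> gens N L.
      if x = (i, j, \<alpha>) then (if y = (k, l, \<beta>) then lie x y else 0) else 0)"
    unfolding poisson_def pdiff_E by (intro sum.cong refl) simp
  also have "\<dots> = (\<Sum>x \<in> gens N L. if x = (i, j, \<alpha>) then
      (\<Sum>y \<in> gens N L. if y = (k, l, \<beta>) then lie x y else 0) else 0)"
    by (intro sum.cong refl) simp
  also have "\<dots> = lie (i, j, \<alpha>) (k, l, \<beta>)"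
    using assms by (simp only: sum.delta finite_gens if_True)
  finally show ?thesis .
qed

lemma poisson_skew: "poisson N L f g = - poisson N L g f"
  unfolding poisson_def
  by (subst sum.swap, subst lie_skew) (simp add: sum_negf mult_ac)

lemma poisson_add_right: "poisson N L f (g + h) = poisson N L f g + poisson N L f h"
  by (simp add: poisson_def pdiff_add algebra_simps sum.distrib)

lemma poisson_scale_right:
  "poisson N L f (Poly_Mapping.single 0 c * g) = Poly_Mapping.single 0 c * poisson N L f g"
  by (simp add: poisson_def pdiff_mult pdiff_single sum_distrib_left mult_ac)

lemma poisson_leibniz: "poisson N L f (g * h) = poisson N L f g * h + g * poisson N L f h"
  by (simp add: poisson_def pdiff_mult algebra_simps sum.distrib sum_distrib_left)

section \<open>Invariants, the projections and the projective limit\<close>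

text \<open>
  The adjoint action of an element of gl(N) on S(N, L) along the diagonal embedding is the
  derivation extending the Lie bracket, i.e. the Poisson bracket with the diagonal image.
  By linearity, invariance under gl_d(N) is tested on its basis E_ij with d < i, j and i, j at
  most N.
\<close>

definition diag :: "nat \<Rightarrow> nat \<Rightarrow> nat \<Rightarrow> spoly" where
  "diag L i j = (\<Sum>\<alpha> = 1..L. E i j \<alpha>)"

definition P_level :: "nat \<Rightarrow> nat \<Rightarrow> nat \<Rightarrow> spoly set" where
  "P_level d L N =
     {f \<in> Sym N L. \<forall>i \<in> {d<..N}. \<forall>j \<in> {d<..N}. poisson N L (diag L i j) f = 0}"

definition I_plus :: "nat \<Rightarrow> nat \<Rightarrow> spoly set" where
  "I_plus N L = {\<Sum>i = 1..N. \<Sum>\<alpha> = 1..L. c i \<alpha> * E i N \<alpha> | c. \<forall>i \<alpha>. c i \<alpha> \<in> Sym N L}"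

text \<open>
  The map from level N to level N - 1 (for N at least 1): the component in S(N - 1, L) with respect
  to the decomposition of P_level (N - 1) L N as the direct sum of S(N - 1, L) and its intersection
  with the ideal.
\<close>

definition proj :: "nat \<Rightarrow> nat \<Rightarrow> spoly \<Rightarrow> spoly" where
  "proj N L f = (THE g. g \<in> Sym (N - 1) L \<and> f - g \<in> P_level (N - 1) L N \<inter> I_plus N L)"

text \<open>
  Elements of the limit are sequences indexed by the N with N at least d; they are represented as
  functions on all natural numbers that vanish below d.  The limit is taken in graded algebras: its
  k-th component is the limit of the k-th components, and the limit is the direct sum of these.
\<close>

type_synonym spseq = "nat \<Rightarrow> spoly"

definition P_comp :: "nat \<Rightarrow> nat \<Rightarrow> nat \<Rightarrow> spseq set" where
  "P_comp d L k = {f. (\<forall>N < d. f N = 0)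
     \<and> (\<forall>N \<ge> d. f N \<in> P_level d L N \<and> homogeneous k (f N))
     \<and> (\<forall>N > d. proj N L (f N) = f (N - 1))}"

definition P_lim :: "nat \<Rightarrow> nat \<Rightarrow> spseq set" where
  "P_lim d L = {\<Sum>k\<le>D. g k | g D. \<forall>k. g k \<in> P_comp d L k}"

text \<open>The embedding of P_lim 0 L into P_lim d L.\<close>

definition res :: "nat \<Rightarrow> spseq \<Rightarrow> spseq" where
  "res d f = (\<lambda>N. if d \<le> N then f N else 0)"

text \<open>
  The bracket of P_lim d L has no specified value outside the carrier, so an equation for it is
  meaningful only together with membership of both arguments in P_lim d L.
\<close>

definition P_bracket :: "nat \<Rightarrow> nat \<Rightarrow> spseq \<Rightarrow> spseq \<Rightarrow> spseq" where
  "P_bracket d L = (\<lambda>f \<in> P_lim d L. \<lambda>g \<in> P_lim d L. res d (\<lambda>N. poisson N L (f N) (g N)))"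

section \<open>Words and generators\<close>

definition words :: "nat \<Rightarrow> nat list set" where
  "words L = {w. w \<noteq> [] \<and> set w \<subseteq> {1..L}}"

definition cyc_rel :: "nat \<Rightarrow> (nat list \<times> nat list) set" where
  "cyc_rel L = {(u, v). u \<in> words L \<and> (\<exists>k. v = rotate k u)}"

definition circular_words :: "nat \<Rightarrow> nat list set set" where
  "circular_words L = words L // cyc_rel L"

text \<open>
  Words are lists, so w ! k is the letter number k + 1.  In p_open the summation indices are
  a 1, ..., a (n - 1); in p_word they are a 0, ..., a (n - 1), the index a k being the row index
  of the factor for w ! k.
\<close>

definition p_open :: "nat \<Rightarrow> nat \<Rightarrow> nat \<Rightarrow> nat list \<Rightarrow> spseq" where
  "p_open d i j w = res d (\<lambda>N. \<Sum>a \<in> {1..<length w} \<rightarrow>\<^sub>E {1..N}. \<Prod>k < length w.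
     E (if k = 0 then i else a k) (if Suc k = length w then j else a (Suc k)) (w ! k))"

definition p_word :: "nat list \<Rightarrow> spseq" where
  "p_word w = (\<lambda>N. \<Sum>a \<in> {..<length w} \<rightarrow>\<^sub>E {1..N}. \<Prod>k < length w.
     E (a k) (a (Suc k mod length w)) (w ! k))"

text \<open>The choice of the representative is immaterial, see p_circ_eq.\<close>

definition p_circ :: "nat list set \<Rightarrow> spseq" where
  "p_circ C = p_word (SOME w. w \<in> C)"

lemma equiv_cyc_rel: "equiv (words L) (cyc_rel L)"
proof (rule equivI)
  show "cyc_rel L \<subseteq> words L \<times> words L"
    by (auto simp: cyc_rel_def words_def)
  show "refl_on (words L) (cyc_rel L)"
    by (auto simp: cyc_rel_def words_def refl_on_def intro: exI[of _ 0])
  show "sym (cyc_rel L)"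
  proof (rule symI)
    fix u v assume "(u, v) \<in> cyc_rel L"
    then obtain k where u: "u \<in> words L" and v: "v = rotate k u"
      by (auto simp: cyc_rel_def)
    let ?m = "k * length u - k"
    have "length u \<ge> 1" using u by (cases u) (auto simp: words_def)
    then have "?m + k = k * length u" by simp
    then have "rotate ?m v = u" by (simp add: v rotate_rotate rotate_id)
    then show "(v, u) \<in> cyc_rel L"
      using u by (auto simp: cyc_rel_def words_def v intro: exI[of _ ?m])
  qed
  show "trans (cyc_rel L)"
    by (rule transI) (auto simp: cyc_rel_def rotate_rotate)
qed

lemma p_word_rotate1: "p_word (rotate1 w) = p_word w"
proof (cases "w = []")
  case False
  define n where "n = length w"
  have n: "n > 0" using False by (simp add: n_def)
  define s where "s k = Suc k mod n" for k
  define t where "t k = (k + (n - 1)) mod n" for k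
  have st: "s (t k) = k" and ts: "t (s k) = k" if "k < n" for k
  proof -
    show "s (t k) = k" using that n by (simp add: s_def t_def mod_Suc_eq)
    have "t (s k) = (Suc k + (n - 1)) mod n" by (simp only: s_def t_def mod_add_left_eq)
    then show "t (s k) = k" using that n by simp
  qed
  have sl: "s k < n" and tl: "t k < n" for k using n by (auto simp: s_def t_def)
  have bij: "bij_betw s {..<n} {..<n}"
    by (rule bij_betwI[where g = t]) (auto simp: st ts sl tl)
  show ?thesis
  proof (rule ext)
    fix N :: nat
    let ?A = "{..<n} \<rightarrow>\<^sub>E {1..N}"
    let ?r = "\<lambda>h a. restrict (a \<circ> h) {..<n}"
    have "p_word w N = (\<Sum>a\<in>?A. \<Prod>k<n. E (a k) (a (s k)) (w ! k))"
      by (simp add: p_word_def n_def s_def)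
    also have "\<dots> = (\<Sum>a\<in>?A. \<Prod>k<n. E (a (s k)) (a (s (s k))) (w ! s k))"
      by (intro sum.cong refl prod.reindex_bij_betw[OF bij, symmetric])
    also have "\<dots> = (\<Sum>a\<in>?A. \<Prod>k<n. E (a k) (a (s k)) (w ! s k))"
      by (rule sum.reindex_bij_witness[of _ "?r t" "?r s"])
        (auto simp: st ts sl tl fun_eq_iff PiE_iff extensional_def restrict_def)
    also have "\<dots> = p_word (rotate1 w) N"
      using False by (simp add: p_word_def n_def s_def nth_rotate1)
    finally show "p_word (rotate1 w) N = p_word w N" by simp
  qed
qed simp

lemma p_word_rotate: "p_word (rotate k w) = p_word w"
  by (induction k) (simp_all add: p_word_rotate1)

lemma p_circ_eq:
  assumes "C \<in> circular_words L" "w \<in> C"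
  shows "p_circ C = p_word w"
proof -
  have "(SOME w. w \<in> C) \<in> C" using assms(2) by (rule someI)
  then have "(w, SOME w. w \<in> C) \<in> cyc_rel L"
    using assms equiv_cyc_rel[of L] quotient_eq_iff unfolding circular_words_def by metis
  then show ?thesis by (auto simp: cyc_rel_def p_circ_def p_word_rotate)
qed

end

theory Submission
  imports Defs
begin

text \<open>
  Write E(x) for the N by N matrix whose (i, j) entry is the generator E i j x.  At level N the
  element p_ij(z) is the (i, j) entry of the product E(z_1) ... E(z_m), and p of a circular word w
  is the trace of E(w_1) ... E(w_n).  The Lie bracket of gl(N) contracted with an arbitrary matrix
  M over the symmetric algebra is a matrix commutator: summing {E(x)_ab, E(y)_kl} M_lk over k and l
  gives the (a, b) entry of E(x) M - M E(x) if x = y, and 0 otherwise (lie_contract, for M the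
  product along a word).

  The bracket with a fixed element is a derivation, so on an entry of a product of matrices it acts
  factor by factor (derivation_wmat).  Bracketing E(x)_ab with the trace and moving the factors
  around the trace cyclically, the factor number q contributes the commutator of E(x) with
  M_q = E(w_{q+1}) ... E(w_n) E(w_1) ... E(w_{q-1}) when x = w_q (poisson_E_trace).  Applying the
  derivation {-, p(w)} to E(z_1) ... E(z_m) replaces one factor E(z_r) at a time by
  E(z_r) M_q - M_q E(z_r); these are the two terms of the formula (poisson_wmat_trace).

  The bracket of the limit has a prescribed value only on the limit itself, so it remains to see
  that both arguments are compatible sequences of invariants (p_open_in_P_lim, p_word_in_P_lim).
  Invariance is the equivariance of products of matrices under the diagonal gl(N)
  (poisson_diag_wmat).  Compatibility with the projections holds because a path through the index N
  contains a generator from the last column: passing from N to N - 1 discards exactly such paths,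
  so the difference of the two levels lies in the ideal I_plus, and this ideal meets the symmetric
  algebra of level N - 1 in 0 only.
\<close>

section \<open>Words as products of generic matrices\<close>

text \<open>
  The (i, j) entry of the product of the N by N generic matrices along a word.  Recursion with the
  identity matrix for the empty word replaces the sums over index tuples in p_open and p_word, so
  that concatenation of words is matrix multiplication.
\<close>

fun wmat :: "nat \<Rightarrow> nat list \<Rightarrow> nat \<Rightarrow> nat \<Rightarrow> spoly" where
  "wmat N [] i j = (if i = j then 1 else 0)"
| "wmat N (x # w) i j = (\<Sum>a = 1..N. E i a x * wmat N w a j)"

lemma wmat_single: "j \<in> {1..N} \<Longrightarrow> wmat N [x] i j = E i j x"
  by (simp add: if_distrib[of "(*) _"] cong: if_cong)

lemma wmat_append:
  assumes "i \<in> {1..N}"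
  shows "wmat N (u @ v) i j = (\<Sum>k = 1..N. wmat N u i k * wmat N v k j)"
  using assms
proof (induction u arbitrary: i)
  case Nil
  have "(\<Sum>k = 1..N. wmat N [] i k * wmat N v k j) = (\<Sum>k = 1..N. if i = k then wmat N v k j else 0)"
    by (intro sum.cong) auto
  with Nil show ?case by simp
next
  case (Cons x u)
  have "wmat N ((x # u) @ v) i j
      = (\<Sum>a = 1..N. \<Sum>k = 1..N. E i a x * wmat N u a k * wmat N v k j)"
    using Cons.IH by (simp add: sum_distrib_left mult.assoc)
  also have "\<dots> = (\<Sum>k = 1..N. \<Sum>a = 1..N. E i a x * wmat N u a k * wmat N v k j)"
    by (rule sum.swap)
  finally show ?case by (simp add: sum_distrib_right)
qed

lemma wmat_snoc:
  assumes "i \<in> {1..N}" "j \<in> {1..N}"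
  shows "wmat N (w @ [x]) i j = (\<Sum>k = 1..N. wmat N w i k * E k j x)"
  using assms(2) by (simp add: wmat_append[OF assms(1)] wmat_single del: wmat.simps)

lemma sum_PiE_insert:
  assumes "finite S" "x \<notin> S" "finite T"
  shows "(\<Sum>a \<in> insert x S \<rightarrow>\<^sub>E T. f a) = (\<Sum>c \<in> T. \<Sum>b \<in> S \<rightarrow>\<^sub>E T. f (b(x := c)))"
proof -
  have "(\<Sum>a \<in> insert x S \<rightarrow>\<^sub>E T. f a) = (\<Sum>(c, b) \<in> T \<times> (S \<rightarrow>\<^sub>E T). f (b(x := c)))"
    unfolding PiE_insert_eq using inj_combinator[OF assms(2), of "\<lambda>_. T"]
    by (subst sum.reindex) (auto simp: o_def case_prod_unfold)
  then show ?thesis by (simp add: sum.cartesian_product)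
qed

text \<open>
  Expanding a matrix product entrywise gives a sum over paths.  The end point j is kept arbitrary in
  the induction on the word from the right, since the last inner index of the longer path becomes
  the end point of the shorter one.
\<close>

lemma path_sum_wmat:
  assumes "w \<noteq> []" "i \<in> {1..N}" "j \<in> {1..N}"
  shows "(\<Sum>a \<in> {1..<length w} \<rightarrow>\<^sub>E {1..N}. \<Prod>k < length w.
     E (if k = 0 then i else a k) (if Suc k = length w then j else a (Suc k)) (w ! k)) = wmat N w i j"
  using assms(1,3)
proof (induction w arbitrary: j rule: rev_nonempty_induct)
  case (single x)
  then show ?case by (simp add: wmat_single del: wmat.simps)
next
  case (snoc x w)
  define n where "n = length w"
  have n: "n > 0" using snoc.hyps by (simp add: n_def)
  then have ins: "{1..<Suc n} = insert n {1..<n}" by auto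
  let ?f = "\<lambda>j n w a k. E (if k = 0 then i else a k) (if Suc k = n then j else a (Suc k)) (w ! k)"
  have "(\<Sum>a \<in> {1..<Suc n} \<rightarrow>\<^sub>E {1..N}. \<Prod>k < Suc n. ?f j (Suc n) (w @ [x]) a k)
    = (\<Sum>c = 1..N. \<Sum>b \<in> {1..<n} \<rightarrow>\<^sub>E {1..N}. \<Prod>k < Suc n. ?f j (Suc n) (w @ [x]) (b(n := c)) k)"
    unfolding ins by (rule sum_PiE_insert) auto
  also have "\<dots> = (\<Sum>c = 1..N. \<Sum>b \<in> {1..<n} \<rightarrow>\<^sub>E {1..N}. (\<Prod>k < n. ?f c n w b k) * E c j x)"
  proof (intro sum.cong refl)
    fix c b
    have "(\<Prod>k < n. ?f j (Suc n) (w @ [x]) (b(n := c)) k) = (\<Prod>k < n. ?f c n w b k)"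
      by (intro prod.cong refl) (auto simp: n_def nth_append)
    then show "(\<Prod>k < Suc n. ?f j (Suc n) (w @ [x]) (b(n := c)) k) = (\<Prod>k < n. ?f c n w b k) * E c j x"
      using n by (simp add: n_def)
  qed
  also have "\<dots> = (\<Sum>c = 1..N. wmat N w i c * E c j x)"
    using snoc.IH by (simp add: sum_distrib_right[symmetric] n_def)
  also have "\<dots> = wmat N (w @ [x]) i j"
    using wmat_snoc[OF assms(2) snoc.prems] by simp
  finally show ?case by (simp add: n_def)
qed

lemma p_open_wmat:
  assumes "w \<noteq> []" "i \<in> {1..d}" "j \<in> {1..d}"
  shows "p_open d i j w = res d (\<lambda>N. wmat N w i j)"
  unfolding p_open_def res_def
  by (rule ext) (use assms path_sum_wmat[of w i _ j] in auto)

text \<open>A closed path is a path from its base point c to itself, with c the value of the index a 0.\<close>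

lemma p_word_wmat:
  assumes "w \<noteq> []"
  shows "p_word w N = (\<Sum>c = 1..N. wmat N w c c)"
proof -
  define n where "n = length w"
  have n: "n > 0" using assms by (simp add: n_def)
  then have ins: "{..<n} = insert 0 {1..<n}" by auto
  let ?g = "\<lambda>a k. E (a k) (a (Suc k mod n)) (w ! k)"
  have "p_word w N = (\<Sum>a \<in> {..<n} \<rightarrow>\<^sub>E {1..N}. prod (?g a) {..<n})"
    by (simp add: p_word_def n_def)
  also have "\<dots> = (\<Sum>c = 1..N. \<Sum>b \<in> {1..<n} \<rightarrow>\<^sub>E {1..N}. prod (?g (b(0 := c))) {..<n})"
    by (subst (1) ins, rule sum_PiE_insert) auto
  also have "\<dots> = (\<Sum>c = 1..N. \<Sum>b \<in> {1..<n} \<rightarrow>\<^sub>E {1..N}. \<Prod>k < n.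
      E (if k = 0 then c else b k) (if Suc k = n then c else b (Suc k)) (w ! k))"
  proof (intro sum.cong prod.cong refl)
    fix c b k assume "k \<in> {..<n}"
    then consider "Suc k = n" | "Suc k < n" by fastforce
    then show "?g (b(0 := c)) k
        = E (if k = 0 then c else b k) (if Suc k = n then c else b (Suc k)) (w ! k)"
      by cases auto
  qed
  also have "\<dots> = (\<Sum>c = 1..N. wmat N w c c)"
    using path_sum_wmat[OF assms] by (simp add: n_def)
  finally show ?thesis .
qed

section \<open>The bracket of a generator matrix with a trace\<close>

lemma derivation_one:
  fixes D :: "spoly \<Rightarrow> spoly"
  assumes "\<And>f g. D (f * g) = D f * g + f * D g"
  shows "D 1 = 0"
  using assms[of 1 1] by simp

lemma additive_sum:
  fixes D :: "spoly \<Rightarrow> spoly"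
  assumes "\<And>f g. D (f + g) = D f + D g"
  shows "D (\<Sum>i\<in>I. f i) = (\<Sum>i\<in>I. D (f i))"
proof -
  have "D 0 = 0" using assms[of 0 0] by simp
  then show ?thesis
    by (induction I rule: infinite_finite_induct) (simp_all add: assms)
qed

text \<open>
  The Leibniz rule for a product of matrices.  The derivation is kept abstract because the bracket is
  a derivation in each argument: in the second one the rule expands the product along w, in the
  first one the product along z.
\<close>

lemma derivation_wmat:
  fixes D :: "spoly \<Rightarrow> spoly"
  assumes add: "\<And>f g. D (f + g) = D f + D g"
    and leib: "\<And>f g. D (f * g) = D f * g + f * D g"
    and "i \<in> {1..N}"
  shows "D (wmat N w i j) = (\<Sum>q < length w. \<Sum>k = 1..N. \<Sum>l = 1..N.
    wmat N (take q w) i k * D (E k l (w ! q)) * wmat N (drop (Suc q) w) l j)"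
  using assms(3)
proof (induction w arbitrary: i)
  case Nil
  have "D 0 = 0" using add[of 0 0] by simp
  then show ?case using derivation_one[of D] leib by auto
next
  case (Cons x w)
  let ?X = "\<lambda>q k l. D (E k l (w ! q)) * wmat N (drop (Suc q) w) l j"
  have "D (wmat N (x # w) i j)
      = (\<Sum>a = 1..N. D (E i a x) * wmat N w a j) + (\<Sum>a = 1..N. E i a x * D (wmat N w a j))"
    by (simp add: additive_sum[of D, OF add] leib sum.distrib)
  also have "(\<Sum>a = 1..N. D (E i a x) * wmat N w a j)
      = (\<Sum>k = 1..N. if i = k then \<Sum>l = 1..N. D (E k l x) * wmat N w l j else 0)"
    using Cons.prems by simp
  also have "\<dots> = (\<Sum>k = 1..N. \<Sum>l = 1..N. wmat N [] i k * D (E k l x) * wmat N w l j)"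
    by (intro sum.cong) auto
  also have "(\<Sum>a = 1..N. E i a x * D (wmat N w a j))
      = (\<Sum>a = 1..N. \<Sum>q < length w. \<Sum>k = 1..N. \<Sum>l = 1..N.
          E i a x * wmat N (take q w) a k * ?X q k l)"
    using Cons.IH by (simp add: sum_distrib_left mult.assoc)
  also have "\<dots> = (\<Sum>q < length w. \<Sum>a = 1..N. \<Sum>k = 1..N. \<Sum>l = 1..N.
          E i a x * wmat N (take q w) a k * ?X q k l)"
    by (rule sum.swap)
  also have "\<dots> = (\<Sum>q < length w. \<Sum>k = 1..N. \<Sum>a = 1..N. \<Sum>l = 1..N.
          E i a x * wmat N (take q w) a k * ?X q k l)"
    by (intro sum.cong refl sum.swap)
  also have "\<dots> = (\<Sum>q < length w. \<Sum>k = 1..N. \<Sum>l = 1..N. \<Sum>a = 1..N.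
          E i a x * wmat N (take q w) a k * ?X q k l)"
    by (intro sum.cong refl sum.swap)
  also have "\<dots> = (\<Sum>q < length w. \<Sum>k = 1..N. \<Sum>l = 1..N.
          wmat N (take (Suc q) (x # w)) i k * ?X q k l)"
    by (simp add: sum_distrib_right)
  finally show ?case
    by (simp add: sum.lessThan_Suc_shift mult.assoc del: sum.lessThan_Suc wmat.simps)
qed

lemma poisson_add_left: "poisson N L (f + g) h = poisson N L f h + poisson N L g h"
  by (simp add: poisson_def pdiff_add algebra_simps sum.distrib)

lemma poisson_leibniz_left: "poisson N L (f * g) h = poisson N L f h * g + f * poisson N L g h"
  by (simp add: poisson_def pdiff_mult algebra_simps sum.distrib sum_distrib_left)

text \<open>
  The two Kronecker deltas in the Lie bracket turn the contraction with a matrix into left and right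
  multiplication by the generic matrix, that is, into a commutator.
\<close>

lemma lie_contract:
  assumes "a \<in> {1..N}" "b \<in> {1..N}"
  shows "(\<Sum>k = 1..N. \<Sum>l = 1..N. lie (a, b, \<alpha>) (k, l, \<beta>) * wmat N v l k)
    = (if \<alpha> = \<beta> then wmat N (\<alpha> # v) a b - wmat N (v @ [\<alpha>]) a b else 0)"
proof (cases "\<alpha> = \<beta>")
  case True
  have "(\<Sum>k = 1..N. \<Sum>l = 1..N. lie (a, b, \<alpha>) (k, l, \<beta>) * wmat N v l k)
    = (\<Sum>k = 1..N. \<Sum>l = 1..N. if b = k then E a l \<alpha> * wmat N v l k else 0)
      - (\<Sum>k = 1..N. \<Sum>l = 1..N. if a = l then wmat N v l k * E k b \<alpha> else 0)"
    unfolding sum_subtractf[symmetric] by (intro sum.cong refl) (auto simp: True algebra_simps)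
  also have "(\<Sum>k = 1..N. \<Sum>l = 1..N. if b = k then E a l \<alpha> * wmat N v l k else 0)
      = (\<Sum>k = 1..N. if b = k then \<Sum>l = 1..N. E a l \<alpha> * wmat N v l k else 0)"
    by (intro sum.cong) auto
  finally show ?thesis
    using True assms by (simp add: wmat_snoc)
qed simp

lemma gen_in_gens: "k \<in> {1..N} \<Longrightarrow> l \<in> {1..N} \<Longrightarrow> x \<in> {1..L} \<Longrightarrow> (k, l, x) \<in> gens N L"
  by (simp add: gens_def)

text \<open>
  Differentiating the trace in its factor number q cuts the cyclic product open there; what is left
  is the product along the word that starts after position q and wraps around.
\<close>

lemma poisson_E_trace:
  assumes "a \<in> {1..N}" "b \<in> {1..N}" "\<alpha> \<in> {1..L}" "set w \<subseteq> {1..L}"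
  shows "poisson N L (E a b \<alpha>) (\<Sum>c = 1..N. wmat N w c c) = (\<Sum>q < length w.
    if \<alpha> = w ! q then wmat N (\<alpha> # drop (Suc q) w @ take q w) a b
      - wmat N ((drop (Suc q) w @ take q w) @ [\<alpha>]) a b else 0)"
proof -
  let ?D = "poisson N L (E a b \<alpha>)"
  let ?l = "\<lambda>q k l. lie (a, b, \<alpha>) (k, l, w ! q)"
  have D: "?D (wmat N w c c) = (\<Sum>q < length w. \<Sum>k = 1..N. \<Sum>l = 1..N.
      wmat N (take q w) c k * ?l q k l * wmat N (drop (Suc q) w) l c)" if "c \<in> {1..N}" for c
    unfolding derivation_wmat[of ?D, OF poisson_add_right poisson_leibniz that]
  proof (intro sum.cong refl)
    fix q k l assume *: "q \<in> {..<length w}" "k \<in> {1..N}" "l \<in> {1..N}"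
    then have "w ! q \<in> {1..L}" using assms(4) by (intro subsetD[OF assms(4)]) simp
    then have "?D (E k l (w ! q)) = ?l q k l" using assms * by (intro poisson_gens gen_in_gens)
    then show "wmat N (take q w) c k * ?D (E k l (w ! q)) * wmat N (drop (Suc q) w) l c
      = wmat N (take q w) c k * ?l q k l * wmat N (drop (Suc q) w) l c" by simp
  qed
  have "?D (\<Sum>c = 1..N. wmat N w c c) = (\<Sum>c = 1..N. \<Sum>q < length w. \<Sum>k = 1..N. \<Sum>l = 1..N.
      wmat N (take q w) c k * ?l q k l * wmat N (drop (Suc q) w) l c)"
    by (simp only: additive_sum[of ?D, OF poisson_add_right] D cong: sum.cong)
  also have "\<dots> = (\<Sum>q < length w. \<Sum>c = 1..N. \<Sum>k = 1..N. \<Sum>l = 1..N.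
      wmat N (take q w) c k * ?l q k l * wmat N (drop (Suc q) w) l c)"
    by (rule sum.swap)
  also have "\<dots> = (\<Sum>q < length w. \<Sum>k = 1..N. \<Sum>c = 1..N. \<Sum>l = 1..N.
      wmat N (take q w) c k * ?l q k l * wmat N (drop (Suc q) w) l c)"
    by (intro sum.cong refl sum.swap)
  also have "\<dots> = (\<Sum>q < length w. \<Sum>k = 1..N. \<Sum>l = 1..N. \<Sum>c = 1..N.
      wmat N (take q w) c k * ?l q k l * wmat N (drop (Suc q) w) l c)"
    by (intro sum.cong refl sum.swap)
  also have "\<dots> = (\<Sum>q < length w. \<Sum>k = 1..N. \<Sum>l = 1..N.
      ?l q k l * wmat N (drop (Suc q) w @ take q w) l k)"
    by (intro sum.cong refl) (simp add: wmat_append sum_distrib_left mult_ac del: lie.simps)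
  finally show ?thesis
    by (simp only: lie_contract[OF assms(1,2)])
qed

lemma wmat_insert:
  assumes "i \<in> {1..N}"
  shows "(\<Sum>k = 1..N. \<Sum>l = 1..N. wmat N u i k * wmat N v k l * wmat N t l j)
    = wmat N (u @ v @ t) i j"
  using assms by (simp add: wmat_append sum_distrib_left mult.assoc)

lemma poisson_wmat_trace:
  assumes i: "i \<in> {1..N}" and z: "set z \<subseteq> {1..L}" and w: "set w \<subseteq> {1..L}"
  shows "poisson N L (wmat N z i j) (\<Sum>c = 1..N. wmat N w c c) =
    (\<Sum>r < length z. \<Sum>q < length w. if z ! r = w ! q then
        wmat N (take r z @ [z ! r] @ drop (Suc q) w @ take q w @ drop (Suc r) z) i j
        - wmat N (take r z @ drop (Suc q) w @ take q w @ [z ! r] @ drop (Suc r) z) i j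
      else 0)"
proof -
  let ?D = "\<lambda>f. poisson N L f (\<Sum>c = 1..N. wmat N w c c)"
  let ?v = "\<lambda>q. drop (Suc q) w @ take q w"
  have "?D (wmat N z i j) = (\<Sum>r < length z. \<Sum>k = 1..N. \<Sum>l = 1..N.
      wmat N (take r z) i k * ?D (E k l (z ! r)) * wmat N (drop (Suc r) z) l j)"
    by (rule derivation_wmat[of ?D, OF poisson_add_left poisson_leibniz_left i])
  also have "\<dots> = (\<Sum>r < length z. \<Sum>k = 1..N. \<Sum>l = 1..N. \<Sum>q < length w.
      wmat N (take r z) i k * (if z ! r = w ! q then wmat N (z ! r # ?v q) k l
        - wmat N (?v q @ [z ! r]) k l else 0) * wmat N (drop (Suc r) z) l j)"
  proof (intro sum.cong refl)
    fix r k l assume *: "r \<in> {..<length z}" "k \<in> {1..N}" "l \<in> {1..N}"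
    then have "z ! r \<in> {1..L}" using z by (auto dest!: nth_mem)
    note poisson_E_trace[OF *(2,3) this w]
    then show "wmat N (take r z) i k * ?D (E k l (z ! r)) * wmat N (drop (Suc r) z) l j =
      (\<Sum>q < length w. wmat N (take r z) i k * (if z ! r = w ! q then wmat N (z ! r # ?v q) k l
        - wmat N (?v q @ [z ! r]) k l else 0) * wmat N (drop (Suc r) z) l j)"
      by (simp only: sum_distrib_left sum_distrib_right)
  qed
  also have "\<dots> = (\<Sum>r < length z. \<Sum>k = 1..N. \<Sum>q < length w. \<Sum>l = 1..N.
      wmat N (take r z) i k * (if z ! r = w ! q then wmat N (z ! r # ?v q) k l
        - wmat N (?v q @ [z ! r]) k l else 0) * wmat N (drop (Suc r) z) l j)"
    by (intro sum.cong refl sum.swap)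
  also have "\<dots> = (\<Sum>r < length z. \<Sum>q < length w. \<Sum>k = 1..N. \<Sum>l = 1..N.
      wmat N (take r z) i k * (if z ! r = w ! q then wmat N (z ! r # ?v q) k l
        - wmat N (?v q @ [z ! r]) k l else 0) * wmat N (drop (Suc r) z) l j)"
    by (intro sum.cong refl sum.swap)
  also have "\<dots> = (\<Sum>r < length z. \<Sum>q < length w. if z ! r = w ! q then
        wmat N (take r z @ [z ! r] @ drop (Suc q) w @ take q w @ drop (Suc r) z) i j
        - wmat N (take r z @ drop (Suc q) w @ take q w @ [z ! r] @ drop (Suc r) z) i j
      else 0)"
    (is "?l = ?r")
  proof (intro sum.cong refl)
    fix r q
    show "(\<Sum>k = 1..N. \<Sum>l = 1..N.
      wmat N (take r z) i k * (if z ! r = w ! q then wmat N (z ! r # ?v q) k l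
        - wmat N (?v q @ [z ! r]) k l else 0) * wmat N (drop (Suc r) z) l j) =
      (if z ! r = w ! q then
        wmat N (take r z @ [z ! r] @ drop (Suc q) w @ take q w @ drop (Suc r) z) i j
        - wmat N (take r z @ drop (Suc q) w @ take q w @ [z ! r] @ drop (Suc r) z) i j
      else 0)"
    proof (cases "z ! r = w ! q")
      case True
      show ?thesis
        using wmat_insert[OF i, of "take r z" "z ! r # ?v q" "drop (Suc r) z" j]
          wmat_insert[OF i, of "take r z" "?v q @ [z ! r]" "drop (Suc r) z" j]
        by (simp only: True refl if_True right_diff_distrib left_diff_distrib sum_subtractf
            append.assoc append_Cons append_Nil)
    qed simp
  qed
  finally show ?thesis .
qed

section \<open>Membership of the generators in the projective limit\<close>

lemma Sym_0 [simp]: "0 \<in> Sym N L"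
  by (simp add: Sym_def)

lemma Sym_1 [simp]: "1 \<in> Sym N L"
  by (simp add: Sym_def)

lemma Sym_add: "f \<in> Sym N L \<Longrightarrow> g \<in> Sym N L \<Longrightarrow> f + g \<in> Sym N L"
  using Poly_Mapping.keys_add[of f g] unfolding Sym_def by blast

lemma Sym_diff: "f \<in> Sym N L \<Longrightarrow> g \<in> Sym N L \<Longrightarrow> f - g \<in> Sym N L"
  using keys_diff[of f g] unfolding Sym_def by blast

lemma Sym_sum: "(\<And>x. x \<in> A \<Longrightarrow> f x \<in> Sym N L) \<Longrightarrow> sum f A \<in> Sym N L"
  by (induction A rule: infinite_finite_induct) (auto intro: Sym_add)

lemma Sym_mult:
  assumes "f \<in> Sym N L" "g \<in> Sym N L"
  shows "f * g \<in> Sym N L"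
  unfolding Sym_def
proof (intro CollectI ballI)
  fix m assume "m \<in> Poly_Mapping.keys (f * g)"
  then obtain a b where "m = a + b" "a \<in> Poly_Mapping.keys f" "b \<in> Poly_Mapping.keys g"
    using keys_mult[of f g] by blast
  then show "Poly_Mapping.keys m \<subseteq> gens N L"
    using assms Poly_Mapping.keys_add[of a b] unfolding Sym_def by blast
qed

lemma Sym_E: "(i, j, \<alpha>) \<in> gens N L \<Longrightarrow> E i j \<alpha> \<in> Sym N L"
  by (auto simp: Sym_def E_def)

lemma Sym_mono: "M \<le> N \<Longrightarrow> Sym M L \<subseteq> Sym N L"
  unfolding Sym_def gens_def by fastforce

lemma Sym_wmat:
  assumes "set w \<subseteq> {1..L}" "i \<in> {1..N}" "j \<in> {1..N}"
  shows "wmat N w i j \<in> Sym N L"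
  using assms by (induction w arbitrary: i) (auto intro!: Sym_sum Sym_mult Sym_E gen_in_gens)

lemma homogeneous_0 [simp]: "homogeneous k 0"
  by (simp add: homogeneous_def)

lemma homogeneous_sum: "(\<And>x. x \<in> A \<Longrightarrow> homogeneous k (f x)) \<Longrightarrow> homogeneous k (sum f A)"
proof (induction A rule: infinite_finite_induct)
  case (insert x A)
  then show ?case
    using Poly_Mapping.keys_add[of "f x" "sum f A"] by (fastforce simp: homogeneous_def)
qed auto

lemma degree_add:
  fixes a b :: "gen \<Rightarrow>\<^sub>0 nat"
  shows "(\<Sum>x \<in> Poly_Mapping.keys (a + b). Poly_Mapping.lookup (a + b) x)
    = (\<Sum>x \<in> Poly_Mapping.keys a. Poly_Mapping.lookup a x)
      + (\<Sum>x \<in> Poly_Mapping.keys b. Poly_Mapping.lookup b x)"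
proof -
  let ?A = "Poly_Mapping.keys a \<union> Poly_Mapping.keys b"
  have sup: "(\<Sum>x \<in> Poly_Mapping.keys c. Poly_Mapping.lookup c x)
      = (\<Sum>x \<in> ?A. Poly_Mapping.lookup c x)" if "Poly_Mapping.keys c \<subseteq> ?A" for c
    using that by (intro sum.mono_neutral_left) (auto simp: in_keys_iff)
  \<comment> \<open>all three sums are taken over the common set of variables\<close>
  show ?thesis
    using sup[of a] sup[of b] sup[of "a + b"] Poly_Mapping.keys_add[of a b]
    by (simp add: lookup_add sum.distrib)
qed

lemma homogeneous_mult:
  assumes "homogeneous k f" "homogeneous l g"
  shows "homogeneous (k + l) (f * g)"
  unfolding homogeneous_def
proof
  fix m assume "m \<in> Poly_Mapping.keys (f * g)"
  then obtain a b where "m = a + b" "a \<in> Poly_Mapping.keys f" "b \<in> Poly_Mapping.keys g"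
    using keys_mult[of f g] by blast
  then show "(\<Sum>x \<in> Poly_Mapping.keys m. Poly_Mapping.lookup m x) = k + l"
    using assms by (simp add: homogeneous_def degree_add)
qed

lemma homogeneous_wmat: "homogeneous (length w) (wmat N w i j)"
proof (induction w arbitrary: i)
  case Nil
  show ?case by (simp add: homogeneous_def)
next
  case (Cons x w)
  have "homogeneous 1 (E i a x)" for a by (simp add: homogeneous_def E_def)
  from homogeneous_mult[OF this Cons.IH] show ?case
    by (auto intro!: homogeneous_sum)
qed

text \<open>
  The diagonal copy of gl(N) acts on the generic matrix of each letter in the same way, so the
  formula for one generator carries over to the entries of all products.
\<close>

lemma poisson_diag_E:
  assumes "i \<in> {1..N}" "j \<in> {1..N}" "(a, b, x) \<in> gens N L"
  shows "poisson N L (diag L i j) (E a b x) = (if j = a then E i b x else 0) - (if i = b then E a j x else 0)"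
proof -
  have x: "x \<in> {1..L}" using assms(3) by (simp add: gens_def)
  have "poisson N L (diag L i j) (E a b x) = (\<Sum>\<alpha> = 1..L. poisson N L (E i j \<alpha>) (E a b x))"
    unfolding diag_def by (rule additive_sum[of "\<lambda>f. poisson N L f _"]) (rule poisson_add_left)
  also have "\<dots> = (\<Sum>\<alpha> = 1..L. if \<alpha> = x then lie (i, j, x) (a, b, x) else 0)"
    using assms by (intro sum.cong refl, subst poisson_gens) (auto intro: gen_in_gens)
  also have "\<dots> = lie (i, j, x) (a, b, x)" using x by simp
  finally show ?thesis by simp
qed

text \<open>
  The adjoint action commutes with matrix multiplication: in the Leibniz rule the terms at the inner
  index cancel, and only those at the two outer indices a and b remain.  For a and b at most d < i, j
  these vanish as well, and in the trace they cancel; both give invariance under gl_d(N).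
\<close>

lemma poisson_diag_wmat:
  assumes ij: "i \<in> {1..N}" "j \<in> {1..N}" and "set w \<subseteq> {1..L}" "a \<in> {1..N}" "b \<in> {1..N}"
  shows "poisson N L (diag L i j) (wmat N w a b)
    = (if j = a then wmat N w i b else 0) - (if i = b then wmat N w a j else 0)"
  using assms(3,4)
proof (induction w arbitrary: a)
  case Nil
  let ?D = "poisson N L (diag L i j)"
  have "?D 0 = 0" "?D 1 = 0"
    using poisson_add_right[of N L "diag L i j" 0 0] derivation_one[of ?D, OF poisson_leibniz] by auto
  then show ?case by auto
next
  case (Cons x w)
  let ?D = "poisson N L (diag L i j)"
  let ?W = "wmat N w"
  have "?D (wmat N (x # w) a b) = (\<Sum>c = 1..N. ?D (E a c x) * ?W c b + E a c x * ?D (?W c b))"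
    by (simp add: additive_sum[of ?D, OF poisson_add_right] poisson_leibniz)
  also have "\<dots> = (\<Sum>c = 1..N. (if j = a then E i c x * ?W c b else 0)
      - (if i = c then E a j x * ?W c b else 0)
      + ((if j = c then E a c x * ?W i b else 0) - (if i = b then E a c x * ?W c j else 0)))"
  proof (intro sum.cong refl)
    fix c assume c: "c \<in> {1..N}"
    have dE: "?D (E a c x) = (if j = a then E i c x else 0) - (if i = c then E a j x else 0)"
      using Cons.prems c by (intro poisson_diag_E ij gen_in_gens) auto
    have dW: "?D (?W c b) = (if j = c then ?W i b else 0) - (if i = b then ?W c j else 0)"
      using Cons.prems c by (intro Cons.IH) auto
    show "?D (E a c x) * ?W c b + E a c x * ?D (?W c b)
      = (if j = a then E i c x * ?W c b else 0)
      - (if i = c then E a j x * ?W c b else 0)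
      + ((if j = c then E a c x * ?W i b else 0) - (if i = b then E a c x * ?W c j else 0))"
      unfolding dE dW by (auto simp: algebra_simps)
  qed
  also have "\<dots> = (if j = a then wmat N (x # w) i b else 0) - (if i = b then wmat N (x # w) a j else 0)"
    using ij by (simp add: sum.distrib sum_subtractf)
  finally show ?case .
qed

lemma I_plus_0: "0 \<in> I_plus N L"
  unfolding I_plus_def by (auto intro!: exI[of _ "\<lambda>_ _. 0"])

lemma I_plus_add:
  assumes "f \<in> I_plus N L" "g \<in> I_plus N L"
  shows "f + g \<in> I_plus N L"
proof -
  from assms obtain c c' where
    "f = (\<Sum>i = 1..N. \<Sum>\<alpha> = 1..L. c i \<alpha> * E i N \<alpha>)" "\<forall>i \<alpha>. c i \<alpha> \<in> Sym N L"
    "g = (\<Sum>i = 1..N. \<Sum>\<alpha> = 1..L. c' i \<alpha> * E i N \<alpha>)" "\<forall>i \<alpha>. c' i \<alpha> \<in> Sym N L"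
    unfolding I_plus_def by blast
  then show ?thesis
    unfolding I_plus_def
    by (auto intro!: exI[of _ "\<lambda>i \<alpha>. c i \<alpha> + c' i \<alpha>"] Sym_add simp: distrib_right sum.distrib)
qed

lemma I_plus_sum: "(\<And>x. x \<in> A \<Longrightarrow> f x \<in> I_plus N L) \<Longrightarrow> sum f A \<in> I_plus N L"
  by (induction A rule: infinite_finite_induct) (auto intro: I_plus_add I_plus_0)

lemma I_plus_mult:
  assumes "f \<in> Sym N L" "g \<in> I_plus N L"
  shows "f * g \<in> I_plus N L"
proof -
  from assms(2) obtain c where
    "g = (\<Sum>i = 1..N. \<Sum>\<alpha> = 1..L. c i \<alpha> * E i N \<alpha>)" "\<forall>i \<alpha>. c i \<alpha> \<in> Sym N L"
    unfolding I_plus_def by blast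
  with assms(1) show ?thesis
    unfolding I_plus_def
    by (auto intro!: exI[of _ "\<lambda>i \<alpha>. f * c i \<alpha>"] Sym_mult simp: sum_distrib_left mult.assoc)
qed

lemma I_plus_E:
  assumes "i \<in> {1..N}" "\<alpha> \<in> {1..L}"
  shows "E i N \<alpha> \<in> I_plus N L"
proof -
  let ?c = "\<lambda>k \<beta>. if k = i then if \<beta> = \<alpha> then 1 else 0 else (0::spoly)"
  have "(\<Sum>k = 1..N. \<Sum>\<beta> = 1..L. ?c k \<beta> * E k N \<beta>)
      = (\<Sum>k = 1..N. if k = i then \<Sum>\<beta> = 1..L. if \<beta> = \<alpha> then E k N \<beta> else 0 else 0)"
    by (intro sum.cong refl) (simp add: if_distrib[of "\<lambda>t. t * _"] cong: if_cong)
  also have "\<dots> = E i N \<alpha>" using assms by (simp del: One_nat_def)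
  finally have "E i N \<alpha> = (\<Sum>k = 1..N. \<Sum>\<beta> = 1..L. ?c k \<beta> * E k N \<beta>)" by simp
  moreover have "\<forall>k \<beta>. ?c k \<beta> \<in> Sym N L" by simp
  ultimately show ?thesis unfolding I_plus_def by (intro CollectI exI[of _ ?c] conjI)
qed

text \<open>Every monomial of an element of the ideal contains some generator from the last column.\<close>

lemma Sym_I_plus_disjoint:
  assumes N: "N \<ge> 1" and f: "f \<in> Sym (N - 1) L" "f \<in> I_plus N L"
  shows "f = 0"
proof -
  from f(2) obtain c where c: "f = (\<Sum>i = 1..N. \<Sum>\<alpha> = 1..L. c i \<alpha> * E i N \<alpha>)"
    unfolding I_plus_def by blast
  have "m \<notin> Poly_Mapping.keys f" for m
  proof
    assume m: "m \<in> Poly_Mapping.keys f"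
    then have "Poly_Mapping.lookup f m \<noteq> 0" by (simp add: in_keys_iff)
    then obtain i where "(\<Sum>\<alpha> = 1..L. Poly_Mapping.lookup (c i \<alpha> * E i N \<alpha>) m) \<noteq> 0"
      unfolding c lookup_sum by (rule sum.not_neutral_contains_not_neutral)
    then obtain \<alpha> where "Poly_Mapping.lookup (c i \<alpha> * E i N \<alpha>) m \<noteq> 0"
      by (rule sum.not_neutral_contains_not_neutral)
    then have "m \<in> Poly_Mapping.keys (c i \<alpha> * E i N \<alpha>)" by (simp add: in_keys_iff)
    then obtain a where "m = a + Poly_Mapping.single (i, N, \<alpha>) 1"
      using keys_mult[of "c i \<alpha>" "E i N \<alpha>"] by (auto simp: E_def)
    then have "(i, N, \<alpha>) \<in> Poly_Mapping.keys m"
      by (simp add: in_keys_iff lookup_add)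
    then show False using m f(1) N unfolding Sym_def gens_def by fastforce
  qed
  then show "f = 0" by (metis all_not_in_conv keys_eq_empty)
qed

lemma pdiff_Sym:
  assumes "f \<in> Sym M L" "x \<notin> gens M L"
  shows "pdiff x f = 0"
  unfolding pdiff_def
proof (intro sum.neutral ballI)
  fix m assume "m \<in> Poly_Mapping.keys f"
  then have "Poly_Mapping.lookup m x = 0"
    using assms unfolding Sym_def by (auto simp flip: not_in_keys_iff_lookup_eq_zero)
  then show "Poly_Mapping.single (m - Poly_Mapping.single x 1)
       (Poly_Mapping.lookup f m * of_nat (Poly_Mapping.lookup m x)) = 0" by simp
qed

text \<open>E_NN brackets to zero with all generators whose indices are below N.\<close>

lemma poisson_corner_Sym:
  assumes "f \<in> Sym (N - 1) L" "N \<ge> 1"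
  shows "poisson N L (diag L N N) f = 0"
  unfolding poisson_def
proof (intro sum.neutral ballI)
  fix x y
  have "pdiff x (diag L N N) = 0 \<or> pdiff y f = 0 \<or> lie x y = 0"
  proof (cases "\<exists>\<alpha>. x = (N, N, \<alpha>)")
    case True
    then obtain \<alpha> where x: "x = (N, N, \<alpha>)" by blast
    obtain k l \<beta> where y: "y = (k, l, \<beta>)" by (cases y)
    show ?thesis
    proof (cases "k = N \<or> l = N")
      case True
      then have "y \<notin> gens (N - 1) L" using assms(2) by (auto simp: gens_def y)
      then show ?thesis using pdiff_Sym[OF assms(1)] by simp
    qed (auto simp: x y)
  next
    case False
    then show ?thesis by (auto simp: diag_def pdiff_sum pdiff_E intro!: sum.neutral)
  qed
  then show "pdiff x (diag L N N) * pdiff y f * lie x y = 0" by auto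
qed

lemma poisson_minus_right: "poisson N L f (g - h) = poisson N L f g - poisson N L f h"
  using poisson_add_right[of N L f "g - h" h] by simp

text \<open>
  The projection is computed by exhibiting its value: two candidates differ by an element of the
  ideal that lives at level N - 1, which is 0.  Invariance under the span of E_NN holds for f
  because d < N, and for g because its variables have indices below N.
\<close>

lemma proj_eq:
  assumes N: "N > d" and f: "f \<in> P_level d L N" and g: "g \<in> Sym (N - 1) L"
    and fg: "f - g \<in> I_plus N L"
  shows "proj N L f = g"
  unfolding proj_def
proof (rule the_equality)
  have corner: "{N - 1<..N} = {N}" using N by auto
  have "f - g \<in> Sym N L"
    using f g Sym_mono[of "N - 1" N L] by (auto simp: P_level_def intro: Sym_diff)
  moreover have "poisson N L (diag L N N) (f - g) = 0"
    using f N poisson_corner_Sym[OF g] by (auto simp: P_level_def poisson_minus_right)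
  ultimately show "g \<in> Sym (N - 1) L \<and> f - g \<in> P_level (N - 1) L N \<inter> I_plus N L"
    using g fg by (simp add: P_level_def corner del: One_nat_def)
next
  fix h assume h: "h \<in> Sym (N - 1) L \<and> f - h \<in> P_level (N - 1) L N \<inter> I_plus N L"
  have "(- 1) * (f - g) \<in> I_plus N L"
    using fg by (intro I_plus_mult) (auto simp: Sym_def)
  then have "(f - h) + (- 1) * (f - g) \<in> I_plus N L"
    using h by (intro I_plus_add) auto
  then have "g - h \<in> I_plus N L" by simp
  then have "g - h = 0"
    using N h g by (intro Sym_I_plus_disjoint[of N _ L]) (auto intro: Sym_diff)
  then show "h = g" by simp
qed

lemma P_comp_resI:
  assumes "\<And>N. N \<ge> d \<Longrightarrow> f N \<in> P_level d L N" "\<And>N. N \<ge> d \<Longrightarrow> homogeneous k (f N)"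
    and "\<And>N. N > d \<Longrightarrow> f N - f (N - 1) \<in> I_plus N L"
  shows "res d f \<in> P_comp d L k"
proof -
  have "proj N L (f N) = f (N - 1)" if "N > d" for N
    using that assms by (intro proj_eq) (auto simp: P_level_def)
  then show ?thesis using assms by (auto simp: P_comp_def res_def)
qed

lemma P_comp_subset_P_lim: "P_comp d L k \<subseteq> P_lim d L"
proof
  fix f assume f: "f \<in> P_comp d L k"
  have "res d (\<lambda>_. 0) \<in> P_comp d L l" for l
  proof (rule P_comp_resI)
    show "0 \<in> P_level d L N" for N
      using poisson_add_right[of N L _ 0 0] by (auto simp: P_level_def)
  qed (auto intro: I_plus_0)
  moreover have "res d (\<lambda>_. 0) = 0" by (simp add: res_def fun_eq_iff)
  ultimately have "\<forall>l. (if l = k then f else 0) \<in> P_comp d L l" using f by simp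
  moreover have "f = (\<Sum>l\<le>k. if l = k then f else 0)" by simp
  ultimately show "f \<in> P_lim d L" unfolding P_lim_def by blast
qed

text \<open>
  The difference of two levels is the sum over the paths that visit N after their starting point,
  and the factor that enters N lies in the last column.
\<close>

lemma wmat_diff_I_plus:
  assumes "set w \<subseteq> {1..L}" "i \<in> {1..N}" "j \<in> {1..N}"
  shows "wmat N w i j - wmat (N - 1) w i j \<in> I_plus N L"
  using assms(1,2)
proof (induction w arbitrary: i)
  case Nil
  show ?case by (simp add: I_plus_0)
next
  case (Cons x w)
  have N: "{1..N} = insert N {1..N - 1}" "N \<ge> 1" using Cons.prems by auto
  have "(\<Sum>a = 1..N. E i a x * wmat N w a j)
      = E i N x * wmat N w N j + (\<Sum>a = 1..N - 1. E i a x * wmat N w a j)"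
    using N(2) by (simp only: N(1)) simp
  then have "wmat N (x # w) i j - wmat (N - 1) (x # w) i j
    = wmat N w N j * E i N x
      + (\<Sum>a = 1..N - 1. E i a x * (wmat N w a j - wmat (N - 1) w a j))"
    by (simp add: right_diff_distrib sum_subtractf mult.commute)
  also have "\<dots> \<in> I_plus N L"
  proof (intro I_plus_add I_plus_sum)
    show "wmat N w N j * E i N x \<in> I_plus N L"
      using Cons.prems assms(3) N(2) by (intro I_plus_mult I_plus_E Sym_wmat) auto
    show "E i a x * (wmat N w a j - wmat (N - 1) w a j) \<in> I_plus N L" if "a \<in> {1..N - 1}" for a
      using that Cons.prems by (intro I_plus_mult Cons.IH Sym_E gen_in_gens) auto
  qed
  finally show ?case .
qed

text \<open>
  In the trace at level N the path based at N is absent at level N - 1; its last factor lies in the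
  last column.
\<close>

lemma wmat_last_column_I_plus:
  assumes "set w \<subseteq> {1..L}" "w \<noteq> []" "i \<in> {1..N}"
  shows "wmat N w i N \<in> I_plus N L"
proof -
  obtain u x where w: "w = u @ [x]" using assms(2) by (metis rev_exhaust)
  have "wmat N w i N = (\<Sum>k = 1..N. wmat N u i k * E k N x)"
    using assms(3) unfolding w by (intro wmat_snoc) auto
  also have "\<dots> \<in> I_plus N L"
    using assms w by (intro I_plus_sum I_plus_mult Sym_wmat I_plus_E) auto
  finally show ?thesis .
qed

lemma p_open_in_P_lim:
  assumes "w \<in> words L" "i \<in> {1..d}" "j \<in> {1..d}"
  shows "p_open d i j w \<in> P_lim d L"
proof -
  have w: "w \<noteq> []" "set w \<subseteq> {1..L}" using assms(1) by (auto simp: words_def)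
  have "res d (\<lambda>N. wmat N w i j) \<in> P_comp d L (length w)"
  proof (rule P_comp_resI)
    fix N assume "d \<le> N"
    then show "wmat N w i j \<in> P_level d L N"
      using assms w by (auto simp: P_level_def poisson_diag_wmat intro!: Sym_wmat)
  next
    fix N assume "d < N"
    then show "wmat N w i j - wmat (N - 1) w i j \<in> I_plus N L"
      using assms w by (intro wmat_diff_I_plus) auto
  qed (rule homogeneous_wmat)
  then show ?thesis
    using P_comp_subset_P_lim p_open_wmat[OF w(1) assms(2,3)] by auto
qed

lemma p_word_in_P_lim:
  assumes "w \<in> words L"
  shows "res d (p_word w) \<in> P_lim d L"
proof -
  have w: "w \<noteq> []" "set w \<subseteq> {1..L}" using assms by (auto simp: words_def)
  have p: "p_word w = (\<lambda>N. \<Sum>c = 1..N. wmat N w c c)"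
    using p_word_wmat[OF w(1)] by auto
  have "res d (p_word w) \<in> P_comp d L (length w)"
    unfolding p
  proof (rule P_comp_resI)
    fix N assume "d \<le> N"
    have "poisson N L (diag L i j) (\<Sum>c = 1..N. wmat N w c c) = 0"
      if ij: "i \<in> {1..N}" "j \<in> {1..N}" for i j
    proof -
      have "poisson N L (diag L i j) (\<Sum>c = 1..N. wmat N w c c)
          = (\<Sum>c = 1..N. (if j = c then wmat N w i c else 0) - (if i = c then wmat N w c j else 0))"
        unfolding additive_sum[of "poisson N L _", OF poisson_add_right]
        using ij w by (intro sum.cong refl poisson_diag_wmat) auto
      also have "\<dots> = 0" using ij by (simp add: sum_subtractf)
      finally show ?thesis .
    qed
    then show "(\<Sum>c = 1..N. wmat N w c c) \<in> P_level d L N"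
      using w by (auto simp: P_level_def intro!: Sym_sum Sym_wmat)
  next
    fix N assume "d < N"
    then have N: "{1..N} = insert N {1..N - 1}" "N \<ge> 1" by auto
    have "(\<Sum>c = 1..N. wmat N w c c) = wmat N w N N + (\<Sum>c = 1..N - 1. wmat N w c c)"
      using N(2) by (simp only: N(1)) simp
    then have "(\<Sum>c = 1..N. wmat N w c c) - (\<Sum>c = 1..N - 1. wmat (N - 1) w c c)
      = wmat N w N N + (\<Sum>c = 1..N - 1. wmat N w c c - wmat (N - 1) w c c)"
      by (simp add: sum_subtractf)
    also have "\<dots> \<in> I_plus N L"
      using w N(2)
      by (intro I_plus_add I_plus_sum wmat_last_column_I_plus wmat_diff_I_plus) auto
    finally show "(\<Sum>c = 1..N. wmat N w c c) - (\<Sum>c = 1..N - 1. wmat (N - 1) w c c) \<in> I_plus N L" .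
  qed (intro homogeneous_sum homogeneous_wmat)
  then show ?thesis using P_comp_subset_P_lim by auto
qed

section \<open>The bracket in the limit\<close>

lemma sum_apply: "(\<Sum>x\<in>A. f x) N = (\<Sum>x\<in>A. f x N)" for f :: "'a \<Rightarrow> nat \<Rightarrow> spoly"
  by (induction A rule: infinite_finite_induct) auto

theorem proposition5p3:
  fixes d L i j :: nat and z w :: "nat list" and what :: "nat list set"
  assumes "d \<ge> 1" and "L \<ge> 2"
    and "i \<in> {1..d}" and "j \<in> {1..d}"
    and "z \<in> words L"
    and "what \<in> circular_words L" and "w \<in> what"
  shows "P_bracket d L (p_open d i j z) (res d (p_circ what)) =
    (\<Sum>r = 1..length z. \<Sum>q = 1..length w.
      if z ! (r - 1) = w ! (q - 1) then
        p_open d i j (take (r - 1) z @ [z ! (r - 1)] @ drop q w @ take (q - 1) w @ drop r z)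
        - p_open d i j (take (r - 1) z @ drop q w @ take (q - 1) w @ [z ! (r - 1)] @ drop r z)
      else 0)"
proof
  fix N
  have w: "w \<in> words L"
    using assms(6,7) equiv_cyc_rel[of L] unfolding circular_words_def
    by (meson in_quotient_imp_subset subsetD)
  have p: "p_circ what = p_word w" by (rule p_circ_eq[OF assms(6,7)])
  have wz: "w \<noteq> []" "set w \<subseteq> {1..L}" "z \<noteq> []" "set z \<subseteq> {1..L}"
    using w assms(5) by (auto simp: words_def)
  have "P_bracket d L (p_open d i j z) (res d (p_circ what)) N
      = res d (\<lambda>N. poisson N L (p_open d i j z N) (res d (p_word w) N)) N"
    using p_open_in_P_lim[OF assms(5,3,4)] p_word_in_P_lim[OF w]
    by (simp add: P_bracket_def p)
  also have "\<dots> = res d (\<lambda>N. poisson N L (wmat N z i j) (\<Sum>c = 1..N. wmat N w c c)) N"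
    using wz assms(3,4) by (simp add: res_def p_open_wmat p_word_wmat)
  also have "\<dots> = (\<Sum>r < length z. \<Sum>q < length w. if z ! r = w ! q then
        p_open d i j (take r z @ [z ! r] @ drop (Suc q) w @ take q w @ drop (Suc r) z) N
        - p_open d i j (take r z @ drop (Suc q) w @ take q w @ [z ! r] @ drop (Suc r) z) N
      else 0)"
  proof (cases "d \<le> N")
    case True
    then show ?thesis
      using assms(3,4) wz by (simp add: res_def p_open_wmat poisson_wmat_trace del: One_nat_def cong: if_cong)
  next
    case False
    then show ?thesis by (simp add: res_def p_open_def cong: if_cong)
  qed
  \<comment> \<open>letters are counted from 0 up to here and from 1 in the formula\<close>
  also have "\<dots> = (\<Sum>r = 1..length z. \<Sum>q = 1..length w.
      if z ! (r - 1) = w ! (q - 1) then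
        p_open d i j (take (r - 1) z @ [z ! (r - 1)] @ drop q w @ take (q - 1) w @ drop r z) N
        - p_open d i j (take (r - 1) z @ drop q w @ take (q - 1) w @ [z ! (r - 1)] @ drop r z) N
      else 0)"
    by (simp add: sum.atLeast1_atMost_eq cong: if_cong)
  also have "\<dots> = (\<Sum>r = 1..length z. \<Sum>q = 1..length w.
      if z ! (r - 1) = w ! (q - 1) then
        p_open d i j (take (r - 1) z @ [z ! (r - 1)] @ drop q w @ take (q - 1) w @ drop r z)
        - p_open d i j (take (r - 1) z @ drop q w @ take (q - 1) w @ [z ! (r - 1)] @ drop r z)
      else 0) N"
    unfolding sum_apply by (intro sum.cong refl) auto
  finally show "P_bracket d L (p_open d i j z) (res d (p_circ what)) N = \<dots>" .
qed

end
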